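(* Let $n\ge 1$ be an integer, let $\Bbbk$ be a field whose characteristic is zero or greater than $n$, and let $R=\Bbbk[x_1,x_2,\ldots,x_n]$. Then the algebra $A=R/(x_1^2,x_2^2,\ldots,x_n^2)$ has the strong Lefschetz property with $\ell=x_1+x_2+\cdots+x_n$ as a strong Lefschetz element.
   Context: $R$ carries the standard grading ($\deg x_i=1$), and $A_i$ denotes the degree-$i$ component of a graded quotient $A=R/I$ by a homogeneous ideal $I$. A graded artinian $\Bbbk$-algebra $A=R/I$ is said to have the strong Lefschetz property if there is a linear form $\ell\in A_1$ such that, for all $i\ge 0$ and all $s\ge 0$, the multiplication map $\times\ell^s: A_i\to A_{i+s}$ has maximal rank, i.e. is injective or surjective. Such a linear form $\ell$ is called a strong Lefschetz element of $A$. *)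

theory Defs
  imports "HOL-Algebra.Algebra" "HOL-Library.Poly_Mapping"
begin

text \<open>
  A monomial is a finitely supported exponent vector of type \<open>nat \<Rightarrow>\<^sub>0 nat\<close>, and a polynomial is a
  finitely supported coefficient function on monomials; \<^typ>\<open>'a \<Rightarrow>\<^sub>0 'b\<close> carries the
  convolution product, so this type is the polynomial ring in the variables \<open>x\<^sub>0, x\<^sub>1, \<dots>\<close>.
  The ring in exactly \<open>n\<close> variables is carved out of it as a carrier, so that \<open>n\<close> is an ordinary
  number and the quotients are those of \<open>HOL-Algebra\<close>.
\<close>

type_synonym 'k mpoly = "(nat \<Rightarrow>\<^sub>0 nat) \<Rightarrow>\<^sub>0 'k"

definition mvar :: "nat \<Rightarrow> 'k::field mpoly" where
  "mvar i = Poly_Mapping.single (Poly_Mapping.single i 1) 1"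

definition polynomials :: "nat \<Rightarrow> 'k::field mpoly set" where
  "polynomials n = {p. \<forall>m\<in>Poly_Mapping.keys p. Poly_Mapping.keys m \<subseteq> {1..n}}"

definition mpoly_ring :: "nat \<Rightarrow> 'k::field mpoly ring" where
  "mpoly_ring n = \<lparr>carrier = polynomials n, monoid.mult = (*), monoid.one = 1,
     ring.zero = 0, ring.add = (+)\<rparr>"

lemma mvar_in_mpoly_ring: "i \<in> {1..n} \<Longrightarrow> (mvar i :: 'k::field mpoly) \<in> carrier (mpoly_ring n)"
  by (simp add: mpoly_ring_def polynomials_def mvar_def)

lemma cring_mpoly_ring: "cring (mpoly_ring n :: 'k::field mpoly ring)"
proof (rule cringI)
  have add: "p + q \<in> polynomials n" if "p \<in> polynomials n" "q \<in> polynomials n"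
    for p q :: "'k mpoly"
    using that Poly_Mapping.keys_add[of p q] unfolding polynomials_def by blast
  have uminus: "- p \<in> polynomials n" if "p \<in> polynomials n" for p :: "'k mpoly"
    using that unfolding polynomials_def by (simp add: keys_minus)
  have mult: "p * q \<in> polynomials n" if p: "p \<in> polynomials n" and q: "q \<in> polynomials n"
    for p q :: "'k mpoly"
    unfolding polynomials_def
  proof safe
    fix m i assume "m \<in> Poly_Mapping.keys (p * q)" and i: "i \<in> Poly_Mapping.keys m"
    then obtain a b where ab: "m = a + b" "a \<in> Poly_Mapping.keys p" "b \<in> Poly_Mapping.keys q"
      using Poly_Mapping.keys_mult[of p q] by blast
    with i have "i \<in> Poly_Mapping.keys a \<union> Poly_Mapping.keys b"
      using Poly_Mapping.keys_add[of a b] by blast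
    with ab p q show "i \<in> {1..n}" unfolding polynomials_def by blast
  qed
  have zero_one: "(0 :: 'k mpoly) \<in> polynomials n" "(1 :: 'k mpoly) \<in> polynomials n"
    by (simp_all add: polynomials_def)
  show "abelian_group (mpoly_ring n :: 'k mpoly ring)"
    by (rule abelian_groupI)
      (auto simp: mpoly_ring_def add zero_one algebra_simps intro: uminus bexI[of _ "- _"])
  show "comm_monoid (mpoly_ring n :: 'k mpoly ring)"
    by (rule comm_monoidI) (auto simp: mpoly_ring_def mult zero_one algebra_simps)
qed (auto simp: mpoly_ring_def algebra_simps)

definition monomial_degree :: "(nat \<Rightarrow>\<^sub>0 nat) \<Rightarrow> nat" where
  "monomial_degree m = (\<Sum>j\<in>Poly_Mapping.keys m. Poly_Mapping.lookup m j)"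

definition homogeneous_part :: "nat \<Rightarrow> nat \<Rightarrow> 'k::field mpoly set" where
  "homogeneous_part n d =
     {p \<in> carrier (mpoly_ring n). \<forall>m\<in>Poly_Mapping.keys p. monomial_degree m = d}"

definition homogeneous_ideal :: "nat \<Rightarrow> 'k::field mpoly set \<Rightarrow> bool" where
  "homogeneous_ideal n I \<longleftrightarrow>
     (\<exists>S \<subseteq> (\<Union>d. homogeneous_part n d). I = Idl\<^bsub>mpoly_ring n\<^esub> S)"

locale artinian_ring = ring +
  assumes descending_chain:
    "(\<And>k. ideal (J k) R) \<Longrightarrow> (\<And>k. J (Suc k) \<subseteq> J k) \<Longrightarrow> \<exists>N::nat. \<forall>k\<ge>N. J k = J N"

text \<open>The component \<open>A\<^sub>d\<close> of \<open>A = R/I\<close>, namely the image of \<open>R\<^sub>d\<close> under the quotient map.\<close>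

definition quot_part :: "nat \<Rightarrow> 'k::field mpoly set \<Rightarrow> nat \<Rightarrow> 'k mpoly set set" where
  "quot_part n I d = (\<lambda>p. I +>\<^bsub>mpoly_ring n\<^esub> p) ` homogeneous_part n d"

definition strong_lefschetz_element ::
    "nat \<Rightarrow> 'k::field mpoly set \<Rightarrow> 'k mpoly set \<Rightarrow> bool" where
  "strong_lefschetz_element n I l \<longleftrightarrow>
     l \<in> quot_part n I 1 \<and>
     (let A = mpoly_ring n Quot I in
      \<forall>i s :: nat.
        inj_on (\<lambda>a. (l [^]\<^bsub>A\<^esub> s) \<otimes>\<^bsub>A\<^esub> a) (quot_part n I i) \<or>
        (\<lambda>a. (l [^]\<^bsub>A\<^esub> s) \<otimes>\<^bsub>A\<^esub> a) ` quot_part n I i = quot_part n I (i + s))"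

text \<open>The strong Lefschetz property of \<open>R/I\<close>; that \<open>R/I\<close> is a graded artinian algebra is part
  of the notion.\<close>

definition strong_lefschetz_property :: "nat \<Rightarrow> 'k::field mpoly set \<Rightarrow> bool" where
  "strong_lefschetz_property n I \<longleftrightarrow>
     homogeneous_ideal n I \<and> artinian_ring (mpoly_ring n Quot I) \<and>
     (\<exists>l. strong_lefschetz_element n I l)"


end

theory Submission
  imports Defs "HOL-Library.Function_Algebras"
begin

text \<open>
  The quotient has a basis of squarefree monomials, so it is the space of functions on subsets of
  \<open>{1..n}\<close>, with multiplication by \<open>\<ell>\<close> the operator \<open>F\<close> that moves one level up in the Boolean
  lattice. With the operator \<open>E\<close> that moves one level down, \<open>E F - F E = w\<close> on the sets of size \<open>i\<close>,
  where \<open>w = n - 2 i\<close>. Hence \<open>E F\<^sup>s - F\<^sup>s E = s (w - s + 1) F\<^sup>s\<^sup>-\<^sup>1\<close>, and in the relevant range the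
  factors \<open>s\<close> and \<open>w - s + 1\<close> lie between \<open>1\<close> and \<open>n\<close>, so they are invertible. Injectivity of
  \<open>F\<^sup>s\<close> for \<open>s \<le> w\<close> follows by induction on \<open>i\<close> and \<open>s\<close>. For surjectivity onto weight \<open>w\<close> with
  \<open>s \<le> - w\<close>, an induction from the top level reduces to vectors killed by \<open>F\<close>, on which
  \<open>F\<^sup>s E\<^sup>s\<close> is a nonzero scalar. No dimension count is needed.
\<close>

subsection \<open>Hard Lefschetz for finite weight representations of sl2\<close>

text \<open>The Cartan element \<open>H\<close> is encoded by its eigenspaces: it acts on
  \<open>W w\<close> as the scalar \<open>w\<close>, so \<open>commutator\<close> is the relation
  \<open>[E, F] = H\<close>. Boundedness of the weights anchors the inductions below, and
  \<open>of_nat_nonzero\<close> is the form in which the characteristic enters.\<close>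

locale sl2_module = vector_space scale
  for scale :: "'k::field \<Rightarrow> 'v::ab_group_add \<Rightarrow> 'v" (infixr "*s" 75) +
  fixes E F :: "'v \<Rightarrow> 'v" and W :: "int \<Rightarrow> 'v set" and n :: nat
  assumes E_add: "E (u + v) = E u + E v" and E_scale: "E (c *s v) = c *s E v"
    and F_add: "F (u + v) = F u + F v" and F_scale: "F (c *s v) = c *s F v"
    and subspace_W: "subspace (W w)"
    and E_weight: "v \<in> W w \<Longrightarrow> E v \<in> W (w + 2)"
    and F_weight: "v \<in> W w \<Longrightarrow> F v \<in> W (w - 2)"
    and commutator: "v \<in> W w \<Longrightarrow> E (F v) = F (E v) + of_int w *s v"
    and weight_bounded: "v \<in> W w \<Longrightarrow> \<not> \<bar>w\<bar> \<le> int n \<Longrightarrow> v = 0"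
    and of_nat_nonzero: "0 < m \<Longrightarrow> m \<le> n \<Longrightarrow> of_nat m \<noteq> (0 :: 'k)"
begin

text \<open>This is the symmetry of sl2 that exchanges \<open>E\<close> and \<open>F\<close> and
  negates \<open>H\<close>. Through it, facts about powers of \<open>F\<close> become facts about
  powers of \<open>E\<close>.\<close>

lemma dual: "sl2_module scale F E (\<lambda>w. W (- w)) n"
proof
  fix v w assume v: "v \<in> W (- w)"
  show "F v \<in> W (- (w + 2))" "E v \<in> W (- (w - 2))"
    using F_weight[OF v] E_weight[OF v] by simp_all
  show "F (E v) = E (F v) + of_int w *s v"
    using commutator[OF v] by (simp add: scale_minus_left)
  show "\<not> \<bar>w\<bar> \<le> int n \<Longrightarrow> v = 0"
    using weight_bounded[OF v] by simp
qed (simp_all add: E_add E_scale F_add F_scale subspace_W of_nat_nonzero)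

lemma F_zero: "F 0 = 0"
  using F_scale[of 0 0] by simp

lemma E_zero: "E 0 = 0"
  using E_scale[of 0 0] by simp

section \<open>Powers of \<open>F\<close> and their commutator with \<open>E\<close>\<close>

lemma F_power_add: "(F ^^ s) (u + v) = (F ^^ s) u + (F ^^ s) v"
  by (induction s) (simp_all add: F_add)

lemma F_power_scale: "(F ^^ s) (c *s v) = c *s (F ^^ s) v"
  by (induction s) (simp_all add: F_scale)

lemma F_power_zero: "(F ^^ s) 0 = 0"
  by (induction s) (simp_all add: F_zero)

lemma F_power_weight: "v \<in> W w \<Longrightarrow> (F ^^ s) v \<in> W (w - 2 * int s)"
proof (induction s)
  case (Suc s)
  then show ?case using F_weight[of "(F ^^ s) v" "w - 2 * int s"] by (simp add: algebra_simps)
qed simp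

text \<open>Moving \<open>E\<close> past each of the \<open>s + 1\<close> copies of \<open>F\<close>
  contributes the weight of the vector met there, and
  \<open>w + (w - 2) + ... + (w - 2 s) = (s + 1) (w - s)\<close>.\<close>

lemma commutator_power:
  assumes v: "v \<in> W w"
  shows "E ((F ^^ Suc s) v) =
    (F ^^ Suc s) (E v) + of_int ((int s + 1) * (w - int s)) *s (F ^^ s) v"
proof (induction s)
  case 0
  show ?case using commutator[OF v] by simp
next
  case (Suc s)
  have "E ((F ^^ Suc (Suc s)) v) =
      F (E ((F ^^ Suc s) v)) + of_int (w - 2 * int (Suc s)) *s (F ^^ Suc s) v"
    using commutator[OF F_power_weight[OF v, of "Suc s"]] by simp
  also have "\<dots> = (F ^^ Suc (Suc s)) (E v) +
      (of_int ((int s + 1) * (w - int s)) + of_int (w - 2 * int (Suc s))) *s (F ^^ Suc s) v"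
    unfolding Suc.IH F_add F_scale scale_left_distrib by (simp add: add.assoc)
  also have "(of_int ((int s + 1) * (w - int s)) + of_int (w - 2 * int (Suc s)) :: 'k) =
      of_int ((int (Suc s) + 1) * (w - int (Suc s)))"
    unfolding of_int_add[symmetric] by (rule arg_cong[where f = of_int]) (simp add: algebra_simps)
  finally show ?case .
qed

section \<open>Injectivity and surjectivity of powers of \<open>F\<close>\<close>

lemma of_int_nonzero: "0 < m \<Longrightarrow> m \<le> int n \<Longrightarrow> of_int m \<noteq> (0 :: 'k)"
  using of_nat_nonzero[of "nat m"] by (simp add: of_nat_nat)

text \<open>Since \<open>E\<close> raises the weight, induction downwards from the top weight gives
  the claim for \<open>E v\<close>. Once \<open>E v = 0\<close>, the commutator formula lowers the
  exponent of \<open>F\<close> at the cost of a nonzero scalar.\<close>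

lemma F_power_inj:
  assumes "v \<in> W w" "(F ^^ s) v = 0" "int s \<le> w"
  shows "v = 0"
proof -
  \<comment> \<open>Here \<open>k\<close> bounds the distance of \<open>w\<close> from the top: at
    \<open>k = 0\<close> the weight exceeds \<open>n\<close> and \<open>v\<close> vanishes. The
    exponent \<open>s\<close> is kept arbitrary because the claim for \<open>E v\<close> is used
    with a larger one.\<close>
  have "v \<in> W w \<Longrightarrow> (F ^^ s) v = 0 \<Longrightarrow> int s \<le> w \<Longrightarrow> int n < w + int k \<Longrightarrow> v = 0" for k
  proof (induction k arbitrary: v w s)
    case 0
    then show ?case using weight_bounded[of v w] by simp
  next
    case (Suc k)
    note outer_IH = Suc.IH
    from Suc.prems show ?case
    proof (induction s)
      case (Suc s)
      define c where "c = (of_int ((int s + 1) * (w - int s)) :: 'k)"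
      have eq: "(F ^^ Suc s) (E v) + c *s (F ^^ s) v = 0"
        using commutator_power[OF Suc.prems(1), of s] Suc.prems(2) E_zero by (simp add: c_def)
      \<comment> \<open>One more \<open>F\<close> kills the second summand and leaves a statement
        about \<open>E v\<close> alone, with exponent \<open>s + 2\<close> and weight
        \<open>w + 2\<close>, so the bound on the exponent persists.\<close>
      then have "F ((F ^^ Suc s) (E v) + c *s (F ^^ s) v) = 0"
        by (simp only: F_zero)
      then have "(F ^^ Suc (Suc s)) (E v) = 0"
        using Suc.prems(2) by (simp add: F_add F_scale)
      then have "E v = 0"
        by (rule outer_IH[OF E_weight[OF Suc.prems(1)]]) (use Suc.prems in auto)
      then have c0: "c *s (F ^^ s) v = 0"
        using eq F_power_zero[of "Suc s"] by simp
      show ?case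
      proof (cases "w \<le> int n")
        case True
        \<comment> \<open>From \<open>s < w\<close> and \<open>w \<le> n\<close>, both factors
          \<open>s + 1\<close> and \<open>w - s\<close> lie between \<open>1\<close> and
          \<open>n\<close>.\<close>
        then have "c \<noteq> 0"
          using Suc.prems(3) of_int_nonzero[of "int s + 1"] of_int_nonzero[of "w - int s"]
          by (simp add: c_def)
        then show ?thesis
          using c0 Suc.IH Suc.prems by simp
      qed (use Suc.prems(1) weight_bounded[of v w] in auto)
    qed simp
  qed
  from this[of "nat (int n + 1 - w)"] show ?thesis using assms by simp
qed

text \<open>A lowest weight vector is a highest weight vector of the dual module, so the commutator
  formula there gives \<open>F (E^(s+1) v) = (s + 1) (- w - s) E^s v\<close>. The scalar
  \<open>c\<close> is the product of these nonzero factors.\<close>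

lemma F_E_power_lowest:
  assumes v: "v \<in> W w" and Fv: "F v = 0" and le: "int s \<le> - w" "- w \<le> int n"
  shows "\<exists>c. c \<noteq> 0 \<and> (F ^^ s) ((E ^^ s) v) = c *s v"
  using le(1)
proof (induction s)
  case 0
  show ?case by (intro exI[of _ 1]) simp
next
  case (Suc s)
  interpret dual: sl2_module scale F E "\<lambda>w. W (- w)" n by (rule dual)
  define d where "d = (of_int ((int s + 1) * (- w - int s)) :: 'k)"
  have "F ((E ^^ Suc s) v) = d *s (E ^^ s) v"
    using dual.commutator_power[of v "- w" s] v Fv dual.F_power_zero[of "Suc s"]
    by (simp add: d_def)
  moreover obtain c where c: "c \<noteq> 0" "(F ^^ s) ((E ^^ s) v) = c *s v"
    using Suc by auto
  moreover have "d \<noteq> 0"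
    using Suc.prems le(2) of_int_nonzero[of "int s + 1"] of_int_nonzero[of "- w - int s"]
    by (simp add: d_def)
  ultimately show ?case
    by (intro exI[of _ "d * c"]) (simp add: funpow_swap1 F_power_scale)
qed

text \<open>Induction upwards from the bottom weight: a preimage of \<open>F v\<close> corrects
  \<open>v\<close> to a vector killed by \<open>F\<close>, and on such a vector
  \<open>F^s E^s\<close> is an invertible scalar.\<close>

lemma F_power_surj:
  assumes "v \<in> W w" "int s \<le> - w"
  shows "\<exists>u\<in>W (w + 2 * int s). (F ^^ s) u = v"
proof -
  have "v \<in> W w \<Longrightarrow> int s \<le> - w \<Longrightarrow> int n < int k - w \<Longrightarrow>
      \<exists>u\<in>W (w + 2 * int s). (F ^^ s) u = v" for k
  proof (induction k arbitrary: v w s)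
    case 0
    then have "v = 0" using weight_bounded[of v w] by simp
    then show ?case using F_power_zero subspace_W subspace_0 by blast
  next
    case (Suc k)
    interpret dual: sl2_module scale F E "\<lambda>w. W (- w)" n by (rule dual)
    show ?case
    proof (cases "- w \<le> int n")
      case False
      then have "v = 0" using weight_bounded[of v w] Suc.prems(1) by simp
      then show ?thesis using F_power_zero subspace_W subspace_0 by blast
    next
      case True
      \<comment> \<open>The preimage of \<open>F v\<close> under \<open>Suc s\<close> powers has
        weight \<open>(w - 2) + 2 (s + 1) = w + 2 s\<close>, which is exactly where a preimage of
        \<open>v\<close> is sought.\<close>
      have "\<exists>u\<in>W (w - 2 + 2 * int (Suc s)). (F ^^ Suc s) u = F v"
        by (rule Suc.IH[OF F_weight[OF Suc.prems(1)]]) (use Suc.prems in auto)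
      then obtain u where u: "u \<in> W (w + 2 * int s)" "(F ^^ Suc s) u = F v"
        by (auto simp: algebra_simps)
      define v' where "v' = v + (- 1) *s (F ^^ s) u"
      have v': "v' \<in> W w"
        unfolding v'_def using Suc.prems(1) F_power_weight[OF u(1), of s]
        by (intro subspace_add subspace_scale subspace_W) simp_all
      have "F v' = 0"
        unfolding v'_def F_add F_scale using u(2) by simp
      then obtain c where c: "c \<noteq> 0" "(F ^^ s) ((E ^^ s) v') = c *s v'"
        using F_E_power_lowest[OF v' _ Suc.prems(2) True] by blast
      have "(E ^^ s) v' \<in> W (w + 2 * int s)"
        using dual.F_power_weight[of v' "- w" s] v' by (simp add: add.commute)
      then have "u + inverse c *s (E ^^ s) v' \<in> W (w + 2 * int s)"
        using u(1) by (intro subspace_add subspace_scale subspace_W)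
      \<comment> \<open>The two summands map to \<open>v - v'\<close> and to
        \<open>v'\<close>.\<close>
      moreover have "(F ^^ s) (u + inverse c *s (E ^^ s) v') = v"
        unfolding F_power_add F_power_scale c(2) using c(1) by (simp add: v'_def)
      ultimately show ?thesis by blast
    qed
  qed
  from this[of "nat (int n + 1 + w)"] show ?thesis using assms by simp
qed

end

subsection \<open>The Boolean lattice\<close>

text \<open>Multiplication by the sum of the variables modulo their squares: the monomial of
  \<open>T\<close> arises from that of \<open>T - {x}\<close> for each \<open>x\<close> in
  \<open>T\<close>. The guard keeps the result supported on subsets of \<open>V\<close>.\<close>

definition lefschetz_raise :: "'a set \<Rightarrow> ('a set \<Rightarrow> 'k::comm_ring_1) \<Rightarrow> 'a set \<Rightarrow> 'k" where
  "lefschetz_raise V f T = (if T \<subseteq> V then \<Sum>x\<in>T. f (T - {x}) else 0)"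

text \<open>On squarefree polynomials with variables indexed by \<open>V\<close>, this is the sum of
  all partial derivatives.\<close>

definition lefschetz_lower :: "'a set \<Rightarrow> ('a set \<Rightarrow> 'k::comm_ring_1) \<Rightarrow> 'a set \<Rightarrow> 'k" where
  "lefschetz_lower V f S = (\<Sum>x\<in>V - S. f (insert x S))"

text \<open>One level of the Boolean lattice, indexed by its sl2 weight. A value \<open>w\<close>
  attained by no subset of \<open>V\<close> gives the zero space.\<close>

definition weight_space :: "'a set \<Rightarrow> int \<Rightarrow> ('a set \<Rightarrow> 'k::comm_ring_1) set" where
  "weight_space V w = {f. \<forall>S. f S \<noteq> 0 \<longrightarrow> S \<subseteq> V \<and> int (card V) - 2 * int (card S) = w}"

lemma weight_spaceD:
  "f \<in> weight_space V w \<Longrightarrow> f S \<noteq> 0 \<Longrightarrow> S \<subseteq> V"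
  "f \<in> weight_space V w \<Longrightarrow> f S \<noteq> 0 \<Longrightarrow> int (card V) - 2 * int (card S) = w"
  by (auto simp: weight_space_def)

lemma raise_weight:
  assumes "finite V" and f: "f \<in> weight_space V w"
  shows "lefschetz_raise V f \<in> weight_space V (w - 2)"
  unfolding weight_space_def
proof (intro CollectI allI impI)
  fix T assume nz: "lefschetz_raise V f T \<noteq> 0"
  then have T: "T \<subseteq> V" by (auto simp: lefschetz_raise_def split: if_splits)
  with nz obtain x where x: "x \<in> T" "f (T - {x}) \<noteq> 0"
    by (auto simp: lefschetz_raise_def elim: sum.not_neutral_contains_not_neutral)
  have "card T = Suc (card (T - {x}))"
    using x(1) T \<open>finite V\<close> by (metis card.remove finite_subset)
  then show "T \<subseteq> V \<and> int (card V) - 2 * int (card T) = w - 2"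
    using weight_spaceD(2)[OF f x(2)] T by simp
qed

lemma lower_weight:
  assumes "finite V" and f: "f \<in> weight_space V w"
  shows "lefschetz_lower V f \<in> weight_space V (w + 2)"
  unfolding weight_space_def
proof (intro CollectI allI impI)
  fix S assume nz: "lefschetz_lower V f S \<noteq> 0"
  then obtain x where x: "x \<in> V - S" "f (insert x S) \<noteq> 0"
    by (auto simp: lefschetz_lower_def elim: sum.not_neutral_contains_not_neutral)
  have S: "S \<subseteq> V" using weight_spaceD(1)[OF f x(2)] by simp
  then have "card (insert x S) = Suc (card S)"
    using x(1) \<open>finite V\<close> by (auto intro: card_insert_disjoint finite_subset)
  then show "S \<subseteq> V \<and> int (card V) - 2 * int (card S) = w + 2"
    using weight_spaceD(2)[OF f x(2)] S by simp
qed

text \<open>Both compositions share the term \<open>C\<close>, which exchanges some \<open>x\<close>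
  in \<open>S\<close> for some \<open>y\<close> outside. The paths returning to \<open>S\<close>
  number \<open>card (V - S)\<close> when raising first and \<open>card S\<close> when lowering
  first, and the difference is the weight.\<close>

lemma lower_raise_commutator:
  assumes "finite V" and f: "f \<in> weight_space V w"
  shows "lefschetz_lower V (lefschetz_raise V f) S =
    lefschetz_raise V (lefschetz_lower V f) S + of_int w * f S"
proof (cases "S \<subseteq> V")
  case False
  then have "f S = 0" using weight_spaceD(1)[OF f] by blast
  then show ?thesis using False by (simp add: lefschetz_raise_def lefschetz_lower_def)
next
  case S: True
  have fin: "finite S" "finite (V - S)" using S \<open>finite V\<close> by (auto intro: finite_subset)
  define C where "C = (\<Sum>y\<in>V - S. \<Sum>x\<in>S. f (insert y (S - {x})))"
  have "lefschetz_lower V (lefschetz_raise V f) S = (\<Sum>y\<in>V - S. \<Sum>x\<in>insert y S. f (insert y S - {x}))"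
    using S by (simp add: lefschetz_lower_def lefschetz_raise_def)
  also have "\<dots> = (\<Sum>y\<in>V - S. f S + (\<Sum>x\<in>S. f (insert y (S - {x}))))"
  proof (rule sum.cong[OF refl])
    fix y assume y: "y \<in> V - S"
    have "(\<Sum>x\<in>S. f (insert y S - {x})) = (\<Sum>x\<in>S. f (insert y (S - {x})))"
      using y by (intro sum.cong refl arg_cong[where f = f]) auto
    then show "(\<Sum>x\<in>insert y S. f (insert y S - {x})) =
        f S + (\<Sum>x\<in>S. f (insert y (S - {x})))"
      using y fin by simp
  qed
  also have "\<dots> = of_nat (card (V - S)) * f S + C"
    by (simp add: sum.distrib C_def)
  finally have du: "lefschetz_lower V (lefschetz_raise V f) S = of_nat (card (V - S)) * f S + C" .
  have "lefschetz_raise V (lefschetz_lower V f) S = (\<Sum>x\<in>S. \<Sum>y\<in>V - (S - {x}). f (insert y (S - {x})))"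
    using S by (simp add: lefschetz_lower_def lefschetz_raise_def)
  also have "\<dots> = (\<Sum>x\<in>S. f S + (\<Sum>y\<in>V - S. f (insert y (S - {x}))))"
  proof (rule sum.cong[OF refl])
    fix x assume x: "x \<in> S"
    then have "V - (S - {x}) = insert x (V - S)" using S by auto
    then show "(\<Sum>y\<in>V - (S - {x}). f (insert y (S - {x}))) =
        f S + (\<Sum>y\<in>V - S. f (insert y (S - {x})))"
      using x fin by (simp add: insert_absorb)
  qed
  also have "\<dots> = of_nat (card S) * f S + C"
    unfolding C_def by (subst sum.swap) (simp add: sum.distrib)
  finally have ud: "lefschetz_raise V (lefschetz_lower V f) S = of_nat (card S) * f S + C" .
  \<comment> \<open>Membership in the weight space ties \<open>w\<close> to \<open>card S\<close>
    only where \<open>f S\<close> is nonzero; elsewhere both sides vanish.\<close>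
  have "of_int w * f S = (of_nat (card (V - S)) - of_nat (card S)) * f S"
  proof (cases "f S = 0")
    case False
    have "int (card (V - S)) = int (card V) - int (card S)"
      using S fin \<open>finite V\<close> by (simp add: card_Diff_subset card_mono of_nat_diff)
    then have "w = int (card (V - S)) - int (card S)"
      using weight_spaceD(2)[OF f False] by simp
    then show ?thesis by simp
  qed simp
  then show ?thesis unfolding du ud by (simp add: algebra_simps)
qed

lemma sl2_module_weight_space:
  assumes V: "finite V" and char: "CHAR('k::field) = 0 \<or> CHAR('k) > card V"
  shows "sl2_module (\<lambda>c (f :: 'a set \<Rightarrow> 'k) S. c * f S)
    (lefschetz_lower V) (lefschetz_raise V) (weight_space V) (card V)"
proof -
  interpret vector_space "\<lambda>c (f :: 'a set \<Rightarrow> 'k) S. c * f S"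
    by standard (auto simp: fun_eq_iff algebra_simps)
  show ?thesis
  proof
    fix f g :: "'a set \<Rightarrow> 'k" and c :: 'k and w :: int and m :: nat
    show "lefschetz_lower V (f + g) = lefschetz_lower V f + lefschetz_lower V g"
      "lefschetz_raise V (f + g) = lefschetz_raise V f + lefschetz_raise V g"
      by (auto simp: fun_eq_iff lefschetz_lower_def lefschetz_raise_def sum.distrib)
    show "lefschetz_lower V (\<lambda>S. c * f S) = (\<lambda>S. c * lefschetz_lower V f S)"
      "lefschetz_raise V (\<lambda>S. c * f S) = (\<lambda>S. c * lefschetz_raise V f S)"
      by (auto simp: fun_eq_iff lefschetz_lower_def lefschetz_raise_def sum_distrib_left)
    show "subspace (weight_space V w :: ('a set \<Rightarrow> 'k) set)"
    proof (rule subspaceI)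
      fix f g :: "'a set \<Rightarrow> 'k" assume fg: "f \<in> weight_space V w" "g \<in> weight_space V w"
      show "f + g \<in> weight_space V w"
        unfolding weight_space_def
      proof (intro CollectI allI impI)
        fix S assume "(f + g) S \<noteq> 0"
        then have "f S \<noteq> 0 \<or> g S \<noteq> 0" by auto
        then show "S \<subseteq> V \<and> int (card V) - 2 * int (card S) = w"
          using weight_spaceD[OF fg(1)] weight_spaceD[OF fg(2)] by blast
      qed
    qed (auto simp: weight_space_def)
    show "\<not> \<bar>w\<bar> \<le> int (card V) \<Longrightarrow> f = 0" if f: "f \<in> weight_space V w"
    proof (rule ccontr)
      assume w: "\<not> \<bar>w\<bar> \<le> int (card V)" and "f \<noteq> 0"
      then obtain S where "f S \<noteq> 0" by (auto simp: fun_eq_iff)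
      with weight_spaceD[OF f this] w card_mono[OF V, of S] show False by auto
    qed
    show "0 < m \<Longrightarrow> m \<le> card V \<Longrightarrow> of_nat m \<noteq> (0 :: 'k)"
      using char by (auto simp: of_nat_eq_0_iff_char_dvd dest: dvd_imp_le)
    show "lefschetz_lower V f \<in> weight_space V (w + 2)" "lefschetz_raise V f \<in> weight_space V (w - 2)"
      "lefschetz_lower V (lefschetz_raise V f) = lefschetz_raise V (lefschetz_lower V f) + (\<lambda>S. of_int w * f S)"
      if "f \<in> weight_space V w"
      using that V by (auto simp: lower_weight raise_weight lower_raise_commutator fun_eq_iff)
  qed
qed

subsection \<open>Chains of subspaces\<close>

text \<open>Induction on the support, splitting each space by evaluation at a new point
  \<open>x\<close>. The kernels stabilise by induction, and the images are decreasing subspaces of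
  the one-dimensional space \<open>'k\<close>.\<close>

lemma descending_subspaces_stabilise:
  fixes W :: "nat \<Rightarrow> ('x \<Rightarrow> 'k::field) set"
  assumes "finite V"
    and "\<And>k f. f \<in> W k \<Longrightarrow> {x. f x \<noteq> 0} \<subseteq> V"
    and "\<And>k f g. f \<in> W k \<Longrightarrow> g \<in> W k \<Longrightarrow> (\<lambda>x. f x + g x) \<in> W k"
    and "\<And>k c f. f \<in> W k \<Longrightarrow> (\<lambda>x. c * f x) \<in> W k"
    and "\<And>k. W (Suc k) \<subseteq> W k"
  shows "\<exists>N. \<forall>k\<ge>N. W k = W N"
  using assms
proof (induction V arbitrary: W rule: finite_induct)
  case empty
  have zero: "f = 0" if "f \<in> W k" for f k
    using empty(1)[OF that] by (auto simp: fun_eq_iff)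
  have dec: "W k \<subseteq> W j" if "j \<le> k" for j k
    using lift_Suc_antimono_le[of W, OF empty(4) that] .
  \<comment> \<open>The closure conditions admit the empty set, so on empty support each
    \<open>W k\<close> is \<open>{}\<close> or \<open>{0}\<close>.\<close>
  show ?case
  proof (cases "\<exists>k. W k = {}")
    case True
    then show ?thesis using dec by (metis subset_empty)
  next
    case False
    then have "W k = {0}" for k using zero by blast
    then show ?thesis by simp
  qed
next
  case (insert x V)
  have dec: "W k \<subseteq> W j" if "j \<le> k" for j k
    using lift_Suc_antimono_le[of W, OF insert.prems(4) that] .
  have "\<exists>N. \<forall>k\<ge>N. {f \<in> W k. f x = 0} = {f \<in> W N. f x = 0}"
  proof (rule insert.IH)
    fix k f assume f: "f \<in> {f \<in> W k. f x = 0}"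
    then show "{x. f x \<noteq> 0} \<subseteq> V" using insert.prems(1)[of f k] by auto
    show "(\<lambda>x. c * f x) \<in> {f \<in> W k. f x = 0}" for c
      using f insert.prems(3)[of f k c] by simp
    show "(\<lambda>x. f x + g x) \<in> {f \<in> W k. f x = 0}" if "g \<in> {f \<in> W k. f x = 0}" for g
      using f that by (intro CollectI conjI insert.prems(2)) auto
  next
    fix k show "{f \<in> W (Suc k). f x = 0} \<subseteq> {f \<in> W k. f x = 0}"
      using insert.prems(4) by blast
  qed
  then obtain N1 where N1: "{f \<in> W k. f x = 0} = {f \<in> W N1. f x = 0}" if "k \<ge> N1" for k
    by blast
  have "\<exists>N\<ge>N1. (\<forall>k. \<exists>g\<in>W k. g x \<noteq> 0) \<or> (\<forall>g\<in>W N. g x = 0)"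
    using dec by (meson nle_le subset_eq)
  then obtain N where N: "N \<ge> N1" "(\<forall>k. \<exists>g\<in>W k. g x \<noteq> 0) \<or> (\<forall>g\<in>W N. g x = 0)"
    by blast
  have "W N \<subseteq> W k" if k: "k \<ge> N" for k
  proof
    fix f assume f: "f \<in> W N"
    have eq: "{f \<in> W k. f x = 0} = {f \<in> W N. f x = 0}"
      using N1[of k] N1[OF N(1)] N(1) k by simp
    show "f \<in> W k"
    proof (cases "\<forall>k. \<exists>g\<in>W k. g x \<noteq> 0")
      case True
      then obtain g where g: "g \<in> W k" "g x \<noteq> 0" by blast
      then have gN: "g \<in> W N" using dec k by blast
      \<comment> \<open>Subtracting the multiple of \<open>g\<close> that agrees with
        \<open>f\<close> at \<open>x\<close> lands in the kernel of evaluation, which is the same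
        for \<open>k\<close> and \<open>N\<close>. Since \<open>g\<close> lies in
        \<open>W k\<close>, it can be added back there.\<close>
      have "(\<lambda>y. f y + - (f x / g x) * g y) \<in> {f \<in> W N. f x = 0}"
        using insert.prems(2)[OF f insert.prems(3)[OF gN, of "- (f x / g x)"]] g(2) by simp
      then have "(\<lambda>y. f y + - (f x / g x) * g y) \<in> W k" using eq by blast
      from insert.prems(2)[OF this insert.prems(3)[OF g(1)], of "f x / g x"]
      show ?thesis by (simp add: add.assoc)
    next
      case False
      then have "f \<in> {f \<in> W N. f x = 0}" using N(2) f by blast
      then show ?thesis using eq by blast
    qed
  qed
  then show ?case using dec by blast
qed

subsection \<open>Squarefree coefficients of polynomials\<close>

definition sqfree_monomial :: "nat set \<Rightarrow> nat \<Rightarrow>\<^sub>0 nat" where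
  "sqfree_monomial S = (\<Sum>i\<in>S. Poly_Mapping.single i 1)"

text \<open>The guard matters: \<open>sqfree_monomial\<close> is \<open>0\<close> on infinite sets.\<close>

definition sqfree_coeffs :: "nat \<Rightarrow> 'k::field mpoly \<Rightarrow> nat set \<Rightarrow> 'k" where
  "sqfree_coeffs n p S = (if S \<subseteq> {1..n} then Poly_Mapping.lookup p (sqfree_monomial S) else 0)"

lemma lookup_sqfree_monomial:
  "finite S \<Longrightarrow> Poly_Mapping.lookup (sqfree_monomial S) i = (if i \<in> S then 1 else 0)"
  by (simp add: sqfree_monomial_def lookup_sum lookup_single when_def)

lemma keys_sqfree_monomial: "finite S \<Longrightarrow> Poly_Mapping.keys (sqfree_monomial S) = S"
  by (rule Set.set_eqI) (simp add: in_keys_iff lookup_sqfree_monomial)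

lemma sqfree_monomial_keys:
  assumes "\<And>i. Poly_Mapping.lookup m i \<le> 1"
  shows "sqfree_monomial (Poly_Mapping.keys m) = m"
proof (rule poly_mapping_eqI)
  fix i show "Poly_Mapping.lookup (sqfree_monomial (Poly_Mapping.keys m)) i = Poly_Mapping.lookup m i"
    using assms[of i] by (auto simp: lookup_sqfree_monomial in_keys_iff)
qed

lemma monomial_degree_sqfree: "finite S \<Longrightarrow> monomial_degree (sqfree_monomial S) = card S"
  by (simp add: monomial_degree_def keys_sqfree_monomial lookup_sqfree_monomial)

lemma sqfree_monomial_eq_iff:
  "finite S \<Longrightarrow> finite T \<Longrightarrow> sqfree_monomial S = sqfree_monomial T \<longleftrightarrow> S = T"
  by (metis keys_sqfree_monomial)

text \<open>By cancellation, \<open>a + b = a + q\<close> forces \<open>q = b\<close>, so one term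
  of the convolution survives.\<close>

lemma lookup_single_mult:
  fixes p :: "'m::cancel_comm_monoid_add \<Rightarrow>\<^sub>0 'k::comm_ring_1"
  shows "Poly_Mapping.lookup (Poly_Mapping.single a c * p) (a + b) = c * Poly_Mapping.lookup p b"
proof -
  have "Poly_Mapping.lookup (Poly_Mapping.single a c * p) (a + b) =
      Sum_any (\<lambda>l. c * Sum_any (\<lambda>q. Poly_Mapping.lookup p q when a + b = l + q) when a = l)"
    unfolding lookup_mult by (simp add: lookup_single when_mult)
  also have "\<dots> = c * Poly_Mapping.lookup p b"
    by simp
  finally show ?thesis .
qed

text \<open>A squarefree monomial is divisible by the variable exactly when
  \<open>i \<in> S\<close>, and the quotient is then the monomial of \<open>S - {i}\<close>.
  Products that acquire a square are invisible to these coefficients.\<close>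

lemma sqfree_coeffs_mvar_mult:
  assumes i: "i \<in> {1..n}"
  shows "sqfree_coeffs n (mvar i * p) S =
    (if S \<subseteq> {1..n} \<and> i \<in> S then sqfree_coeffs n p (S - {i}) else 0)"
proof (cases "S \<subseteq> {1..n}")
  case S: True
  then have fin: "finite S" by (rule finite_subset) simp
  show ?thesis
  proof (cases "i \<in> S")
    case True
    then have "sqfree_monomial S = Poly_Mapping.single i 1 + sqfree_monomial (S - {i})"
      unfolding sqfree_monomial_def using fin by (simp add: sum.remove)
    moreover have "S - {i} \<subseteq> {1..n}" using S by blast
    ultimately show ?thesis
      using S True by (simp add: sqfree_coeffs_def mvar_def lookup_single_mult)
  next
    case False
    have "sqfree_monomial S \<notin> Poly_Mapping.keys (mvar i * p)"
    proof
      assume "sqfree_monomial S \<in> Poly_Mapping.keys (mvar i * p)"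
      then obtain b where b: "sqfree_monomial S = Poly_Mapping.single i 1 + b"
        using keys_mult[of "mvar i :: 'a mpoly" p] by (auto simp: mvar_def)
      have "Poly_Mapping.lookup (sqfree_monomial S) i \<ge> 1"
        unfolding b by (simp add: lookup_add)
      with False fin show False by (simp add: lookup_sqfree_monomial)
    qed
    then show ?thesis
      using False by (simp add: sqfree_coeffs_def in_keys_iff)
  qed
qed (simp add: sqfree_coeffs_def)

section \<open>Linearity of the coefficients and the action of the Lefschetz form\<close>

lemma sqfree_coeffs_zero: "sqfree_coeffs n 0 = 0"
  by (simp add: sqfree_coeffs_def fun_eq_iff)

lemma sqfree_coeffs_add: "sqfree_coeffs n (p + q) = sqfree_coeffs n p + sqfree_coeffs n q"
  by (auto simp: sqfree_coeffs_def fun_eq_iff lookup_add)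

lemma sqfree_coeffs_diff: "sqfree_coeffs n (p - q) = sqfree_coeffs n p - sqfree_coeffs n q"
  by (auto simp: sqfree_coeffs_def fun_eq_iff lookup_minus)

lemma sqfree_coeffs_const_mult:
  "sqfree_coeffs n (Poly_Mapping.single 0 c * p) = (\<lambda>S. c * sqfree_coeffs n p S)"
  using lookup_single_mult[of 0 c p] by (auto simp: sqfree_coeffs_def fun_eq_iff)

lemma sqfree_coeffs_sum_mvar_mult:
  "sqfree_coeffs n ((\<Sum>i\<in>{1..n}. mvar i) * p) = lefschetz_raise {1..n} (sqfree_coeffs n p)"
proof
  fix S :: "nat set"
  have sum: "sqfree_coeffs n (sum f J) S = (\<Sum>i\<in>J. sqfree_coeffs n (f i) S)" if "finite J"
    for f :: "nat \<Rightarrow> 'a mpoly" and J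
    using that by (induction J rule: finite_induct) (simp_all add: sqfree_coeffs_zero sqfree_coeffs_add)
  have "sqfree_coeffs n ((\<Sum>i\<in>{1..n}. mvar i) * p) S =
      (\<Sum>i\<in>{1..n}. if S \<subseteq> {1..n} \<and> i \<in> S then sqfree_coeffs n p (S - {i}) else 0)"
    unfolding sum_distrib_right sum[OF finite_atLeastAtMost]
    by (rule sum.cong[OF refl]) (rule sqfree_coeffs_mvar_mult)
  also have "\<dots> = lefschetz_raise {1..n} (sqfree_coeffs n p) S"
  proof (cases "S \<subseteq> {1..n}")
    case True
    then have "{1..n} \<inter> {i. i \<in> S} = S" by blast
    then show ?thesis using True by (simp only: lefschetz_raise_def sum.If_cases finite_atLeastAtMost) simp
  qed (simp add: lefschetz_raise_def)
  finally show "sqfree_coeffs n ((\<Sum>i\<in>{1..n}. mvar i) * p) S = lefschetz_raise {1..n} (sqfree_coeffs n p) S" .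
qed

lemma sqfree_coeffs_power_mult:
  "sqfree_coeffs n ((\<Sum>i\<in>{1..n}. mvar i) ^ s * p) = (lefschetz_raise {1..n} ^^ s) (sqfree_coeffs n p)"
  by (induction s)
    (simp_all add: mult.assoc sqfree_coeffs_sum_mvar_mult[unfolded One_nat_def])

text \<open>Degree \<open>d\<close> corresponds to sets of size \<open>d\<close>, hence to weight
  \<open>n - 2 d\<close>. For \<open>d > n\<close> both sides are zero, as every monomial of that
  degree has a square factor.\<close>

lemma sqfree_coeffs_homogeneous_part:
  "sqfree_coeffs n ` homogeneous_part n d =
    (weight_space {1..n} (int n - 2 * int d) :: (nat set \<Rightarrow> 'k::field) set)"
proof (intro equalityI subsetI)
  fix f :: "nat set \<Rightarrow> 'k" assume "f \<in> sqfree_coeffs n ` homogeneous_part n d"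
  then obtain p where p: "p \<in> homogeneous_part n d" and f: "f = sqfree_coeffs n p" by blast
  show "f \<in> weight_space {1..n} (int n - 2 * int d)"
    unfolding weight_space_def
  proof (intro CollectI allI impI)
    fix S assume "f S \<noteq> 0"
    then have S: "S \<subseteq> {1..n}" "sqfree_monomial S \<in> Poly_Mapping.keys p"
      by (auto simp: f sqfree_coeffs_def in_keys_iff split: if_splits)
    then have "card S = d"
      using p monomial_degree_sqfree[of S] finite_subset[OF S(1)] by (auto simp: homogeneous_part_def)
    with S(1) show "S \<subseteq> {1..n} \<and> int (card {1..n}) - 2 * int (card S) = int n - 2 * int d"
      by simp
  qed
next
  fix f :: "nat set \<Rightarrow> 'k" assume f: "f \<in> weight_space {1..n} (int n - 2 * int d)"
  \<comment> \<open>The squarefree representative of \<open>f\<close>; the weight condition makes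
    all its monomials have degree \<open>d\<close>.\<close>
  define p where "p = (\<Sum>S\<in>Pow {1..n}. Poly_Mapping.single (sqfree_monomial S) (f S))"
  have lookup_p: "Poly_Mapping.lookup p m =
      (\<Sum>S\<in>Pow {1..n}. if sqfree_monomial S = m then f S else 0)" for m
    unfolding p_def by (simp add: lookup_sum lookup_single when_def)
  have "sqfree_coeffs n p = f"
  proof
    fix S
    have "Poly_Mapping.lookup p (sqfree_monomial S) = f S" if S: "S \<subseteq> {1..n}"
    proof -
      have "Poly_Mapping.lookup p (sqfree_monomial S) =
          (\<Sum>T\<in>Pow {1..n}. if T = S then f T else 0)"
        unfolding lookup_p
      proof (rule sum.cong[OF refl])
        fix T assume "T \<in> Pow {1..n}"
        then have "finite T" "finite S" using S by (auto intro: finite_subset)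
        then show "(if sqfree_monomial T = sqfree_monomial S then f T else 0) =
            (if T = S then f T else 0)"
          by (simp add: sqfree_monomial_eq_iff)
      qed
      then show ?thesis using S by simp
    qed
    then show "sqfree_coeffs n p S = f S"
      using weight_spaceD(1)[OF f, of S] by (auto simp: sqfree_coeffs_def)
  qed
  moreover have "Poly_Mapping.keys m \<subseteq> {1..n} \<and> monomial_degree m = d"
    if m: "m \<in> Poly_Mapping.keys p" for m
  proof -
    from m obtain S where S: "S \<subseteq> {1..n}" "sqfree_monomial S = m" "f S \<noteq> 0"
      by (auto simp: in_keys_iff lookup_p split: if_splits elim: sum.not_neutral_contains_not_neutral)
    have "finite S" using S(1) by (rule finite_subset) simp
    then show ?thesis
      using S(1) weight_spaceD(2)[OF f S(3)]
      by (simp add: keys_sqfree_monomial monomial_degree_sqfree flip: S(2))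
  qed
  ultimately show "f \<in> sqfree_coeffs n ` homogeneous_part n d"
    by (intro image_eqI[of _ _ p]) (auto simp: homogeneous_part_def mpoly_ring_def polynomials_def)
qed

subsection \<open>The ideal of squares and its quotient\<close>

lemma mpoly_ring_simps [simp]:
  "carrier (mpoly_ring n) = polynomials n"
  "monoid.mult (mpoly_ring n) = (*)" "monoid.one (mpoly_ring n) = 1"
  "ring.zero (mpoly_ring n) = 0" "ring.add (mpoly_ring n) = (+)"
  by (simp_all add: mpoly_ring_def)

lemma mpoly_ring_pow: "p [^]\<^bsub>mpoly_ring n\<^esub> (s::nat) = p ^ s"
  by (induction s) (simp_all add: mult.commute)

lemma mpoly_ring_uminus:
  assumes "p \<in> polynomials n"
  shows "\<ominus>\<^bsub>mpoly_ring n\<^esub> p = (- p :: 'k::field mpoly)"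
proof -
  interpret cring "mpoly_ring n :: 'k mpoly ring" by (rule cring_mpoly_ring)
  have "- p \<in> polynomials n" using assms by (simp add: polynomials_def)
  then show ?thesis using assms by (intro minus_equality) auto
qed

lemma mpoly_ring_minus:
  "q \<in> polynomials n \<Longrightarrow> p \<ominus>\<^bsub>mpoly_ring n\<^esub> q = (p - q :: 'k::field mpoly)"
  by (simp add: a_minus_def mpoly_ring_uminus)

lemma monomial_in_square_ideal:
  fixes c :: "'k::field"
  assumes m: "Poly_Mapping.keys m \<subseteq> {1..n}" and i: "Poly_Mapping.lookup m i \<ge> 2"
  shows "Poly_Mapping.single m c \<in> Idl\<^bsub>mpoly_ring n\<^esub> ((\<lambda>i. mvar i ^ 2) ` {1..n})"
proof -
  interpret cring "mpoly_ring n :: 'k mpoly ring" by (rule cring_mpoly_ring)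
  \<comment> \<open>Subtraction of exponents is truncated; the hypothesis on
    \<open>lookup m i\<close> ensures that adding back \<open>2\<close> at \<open>i\<close> recovers
    \<open>m\<close>.\<close>
  define b where "b = m - Poly_Mapping.single i 2"
  have m_eq: "m = b + Poly_Mapping.single i 2"
    using i by (intro poly_mapping_eqI) (auto simp: b_def lookup_add lookup_minus lookup_single when_def)
  have "i \<in> Poly_Mapping.keys m" using i by (simp add: in_keys_iff)
  with m have "i \<in> {1..n}" by blast
  have "Poly_Mapping.keys b \<subseteq> {1..n}"
    using m by (auto simp: b_def in_keys_iff lookup_minus)
  then have b: "Poly_Mapping.single b c \<in> polynomials n"
    by (auto simp: polynomials_def)
  have "(mvar ` {1..n} :: 'k mpoly set) \<subseteq> polynomials n"
    using mvar_in_mpoly_ring by fastforce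
  then have sq: "(\<lambda>i. mvar i ^ 2) ` {1..n} \<subseteq> carrier (mpoly_ring n :: 'k mpoly ring)"
    using nat_pow_closed[of _ 2] by (auto simp: mpoly_ring_pow image_subset_iff)
  interpret I: ideal "Idl\<^bsub>mpoly_ring n\<^esub> ((\<lambda>i. mvar i ^ 2) ` {1..n})" "mpoly_ring n :: 'k mpoly ring"
    by (rule genideal_ideal[OF sq])
  have "mvar i ^ 2 \<in> Idl\<^bsub>mpoly_ring n\<^esub> ((\<lambda>i. mvar i ^ 2 :: 'k mpoly) ` {1..n})"
    using genideal_self[OF sq] \<open>i \<in> {1..n}\<close> by blast
  from I.I_l_closed[OF this, of "Poly_Mapping.single b c"] b
  have "Poly_Mapping.single b c * mvar i ^ 2 \<in> Idl\<^bsub>mpoly_ring n\<^esub> ((\<lambda>i. mvar i ^ 2) ` {1..n})"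
    by simp
  moreover have "Poly_Mapping.single b c * mvar i ^ 2 = Poly_Mapping.single m c"
    unfolding m_eq mvar_def power2_eq_square mult_single
    by (simp flip: single_add numeral_2_eq_2)
  ultimately show ?thesis by simp
qed

lemma poly_mapping_sum_singles:
  "(\<Sum>m\<in>Poly_Mapping.keys p. Poly_Mapping.single m (Poly_Mapping.lookup p m)) = p"
  by (rule poly_mapping_eqI)
    (simp add: lookup_sum lookup_single when_def in_keys_iff)

text \<open>Squarefree monomials in the given variables correspond to subsets of
  \<open>{1..n}\<close>. The description by monomials makes closure under multiplication
  visible.\<close>

lemma sqfree_coeffs_eq_zero_iff:
  assumes p: "p \<in> polynomials n"
  shows "sqfree_coeffs n p = 0 \<longleftrightarrow>
    (\<forall>m\<in>Poly_Mapping.keys p. \<exists>i. Poly_Mapping.lookup m i \<ge> 2)"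
proof
  assume zero: "sqfree_coeffs n p = 0"
  show "\<forall>m\<in>Poly_Mapping.keys p. \<exists>i. Poly_Mapping.lookup m i \<ge> 2"
  proof (intro ballI, rule ccontr)
    fix m assume m: "m \<in> Poly_Mapping.keys p" and "\<nexists>i. Poly_Mapping.lookup m i \<ge> 2"
    then have "Poly_Mapping.lookup m i \<le> 1" for i
      by (metis not_less_eq_eq one_add_one plus_1_eq_Suc)
    then have "sqfree_monomial (Poly_Mapping.keys m) = m" by (rule sqfree_monomial_keys)
    moreover have "Poly_Mapping.keys m \<subseteq> {1..n}" using p m by (auto simp: polynomials_def)
    ultimately have "sqfree_coeffs n p (Poly_Mapping.keys m) = Poly_Mapping.lookup p m"
      by (simp add: sqfree_coeffs_def)
    with zero m show False by (simp add: in_keys_iff)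
  qed
next
  assume *: "\<forall>m\<in>Poly_Mapping.keys p. \<exists>i. Poly_Mapping.lookup m i \<ge> 2"
  show "sqfree_coeffs n p = 0"
  proof
    fix S
    have "Poly_Mapping.lookup p (sqfree_monomial S) = 0" if "S \<subseteq> {1..n}"
    proof (rule ccontr)
      assume "Poly_Mapping.lookup p (sqfree_monomial S) \<noteq> 0"
      then have "sqfree_monomial S \<in> Poly_Mapping.keys p" by (simp add: in_keys_iff)
      with * obtain i where i: "Poly_Mapping.lookup (sqfree_monomial S) i \<ge> 2" by blast
      have "finite S" using that by (rule finite_subset) simp
      with i show False by (cases "i \<in> S") (simp_all add: lookup_sqfree_monomial)
    qed
    then show "sqfree_coeffs n p S = 0 S" by (simp add: sqfree_coeffs_def)
  qed
qed

text \<open>The right side is an ideal containing the generators, so minimality gives one inclusion.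
  Conversely, each of its elements is a sum of monomials divisible by a squared variable.\<close>

lemma square_ideal_eq:
  "Idl\<^bsub>mpoly_ring n\<^esub> ((\<lambda>i. mvar i ^ 2) ` {1..n}) =
    {p \<in> polynomials n. sqfree_coeffs n p = (0 :: nat set \<Rightarrow> 'k::field)}"
    (is "?I = ?K")
proof
  interpret cring "mpoly_ring n :: 'k mpoly ring" by (rule cring_mpoly_ring)
  have mvar: "(mvar i :: 'k mpoly) \<in> polynomials n" if "i \<in> {1..n}" for i
    using mvar_in_mpoly_ring[OF that] by simp
  have mvar_sq: "(mvar i ^ 2 :: 'k mpoly) \<in> polynomials n" if "i \<in> {1..n}" for i
    using nat_pow_closed[of "mvar i" 2] mvar[OF that] by (simp add: mpoly_ring_pow)
  have sq: "(\<lambda>i. mvar i ^ 2) ` {1..n} \<subseteq> carrier (mpoly_ring n :: 'k mpoly ring)"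
    using mvar_sq by auto
  interpret I: ideal ?I "mpoly_ring n :: 'k mpoly ring"
    by (rule genideal_ideal[OF sq])
  \<comment> \<open>Exponents add under multiplication, so an exponent of at least \<open>2\<close>
    in a factor survives in the product.\<close>
  have mult_K: "x * a \<in> ?K" if a: "a \<in> ?K" and x: "x \<in> polynomials n" for a x
  proof -
    have xa: "x * a \<in> polynomials n" using m_closed[of x a] a x by simp
    have "\<exists>i. Poly_Mapping.lookup m i \<ge> 2" if "m \<in> Poly_Mapping.keys (x * a)" for m
    proof -
      from that obtain u v where uv: "m = u + v" "v \<in> Poly_Mapping.keys a"
        using keys_mult[of x a] by blast
      then obtain i where "Poly_Mapping.lookup v i \<ge> 2"
        using a sqfree_coeffs_eq_zero_iff[of a n] by auto
      then show ?thesis by (intro exI[of _ i]) (simp add: uv(1) lookup_add)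
    qed
    then show ?thesis using xa sqfree_coeffs_eq_zero_iff[OF xa] by blast
  qed
  have "ideal ?K (mpoly_ring n)"
  proof (rule idealI)
    show "ring (mpoly_ring n :: 'k mpoly ring)" by (rule ring_axioms)
    show "subgroup ?K (add_monoid (mpoly_ring n))"
    proof (rule group.subgroupI[OF a_group])
      show "?K \<subseteq> carrier (add_monoid (mpoly_ring n))" by auto
      show "?K \<noteq> {}" using zero_closed sqfree_coeffs_zero[of n] by auto
    next
      fix a :: "'k mpoly" assume a: "a \<in> ?K"
      have "inv\<^bsub>add_monoid (mpoly_ring n)\<^esub> a = - a"
        using mpoly_ring_uminus[of a n] a by (simp add: a_inv_def)
      moreover have "- a \<in> polynomials n" using a by (simp add: polynomials_def)
      ultimately show "inv\<^bsub>add_monoid (mpoly_ring n)\<^esub> a \<in> ?K"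
        using a sqfree_coeffs_diff[of n 0 a] by (simp add: sqfree_coeffs_zero)
    next
      fix a b :: "'k mpoly" assume "a \<in> ?K" "b \<in> ?K"
      then show "a \<otimes>\<^bsub>add_monoid (mpoly_ring n)\<^esub> b \<in> ?K"
        using add.m_closed[of a b] by (simp add: sqfree_coeffs_add)
    qed
    show "x \<otimes>\<^bsub>mpoly_ring n\<^esub> a \<in> ?K" "a \<otimes>\<^bsub>mpoly_ring n\<^esub> x \<in> ?K"
      if "a \<in> ?K" "x \<in> carrier (mpoly_ring n)" for a x
      using mult_K[OF that(1), of x] that(2) by (simp_all add: mult.commute)
  qed
  moreover have "(\<lambda>i. mvar i ^ 2) ` {1..n} \<subseteq> ?K"
  proof
    fix p :: "'k mpoly" assume "p \<in> (\<lambda>i. mvar i ^ 2) ` {1..n}"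
    then obtain i where i: "i \<in> {1..n}" "p = mvar i ^ 2" by blast
    have p: "p \<in> polynomials n" using mvar_sq[OF i(1)] i(2) by simp
    have "\<exists>i. Poly_Mapping.lookup m i \<ge> 2" if "m \<in> Poly_Mapping.keys p" for m
    proof
      have "m = Poly_Mapping.single i 1 + Poly_Mapping.single i 1"
        using that by (simp add: i(2) mvar_def power2_eq_square mult_single)
      then show "Poly_Mapping.lookup m i \<ge> 2" by (simp add: lookup_add)
    qed
    with p show "p \<in> ?K" using sqfree_coeffs_eq_zero_iff[OF p] by blast
  qed
  ultimately show "?I \<subseteq> ?K" by (rule genideal_minimal)
  show "?K \<subseteq> ?I"
  proof
    fix p assume "p \<in> ?K"
    then have p: "p \<in> polynomials n" and
      nonsq: "\<forall>m\<in>Poly_Mapping.keys p. \<exists>i. Poly_Mapping.lookup m i \<ge> 2"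
      using sqfree_coeffs_eq_zero_iff[of p n] by simp_all
    have "sum f M \<in> ?I" if "finite M" "\<And>m. m \<in> M \<Longrightarrow> f m \<in> ?I" for f and M :: "(nat \<Rightarrow>\<^sub>0 nat) set"
      using that
    proof (induction M rule: finite_induct)
      case empty
      then show ?case using I.zero_closed by simp
    next
      case (insert x F)
      then show ?case using I.a_closed[of "f x" "sum f F"] by simp
    qed
    moreover have "Poly_Mapping.single m (Poly_Mapping.lookup p m) \<in> ?I"
      if m: "m \<in> Poly_Mapping.keys p" for m
    proof -
      obtain i where "Poly_Mapping.lookup m i \<ge> 2"
        using nonsq m by blast
      moreover have "Poly_Mapping.keys m \<subseteq> {1..n}" using p m by (auto simp: polynomials_def)
      ultimately show ?thesis by (intro monomial_in_square_ideal)
    qed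
    ultimately have "(\<Sum>m\<in>Poly_Mapping.keys p. Poly_Mapping.single m (Poly_Mapping.lookup p m)) \<in> ?I"
      by simp
    then show "p \<in> ?I" by (simp only: poly_mapping_sum_singles)
  qed
qed

section \<open>Homogeneity of the ideal and of the linear form\<close>

lemma homogeneous_ideal_squares:
  "homogeneous_ideal n (Idl\<^bsub>mpoly_ring n\<^esub> ((\<lambda>i. mvar i ^ 2 :: 'k::field mpoly) ` {1..n}))"
  unfolding homogeneous_ideal_def
proof (intro exI conjI)
  show "(\<lambda>i. mvar i ^ 2) ` {1..n} \<subseteq> (\<Union>d. homogeneous_part n d :: 'k mpoly set)"
  proof
    fix p :: "'k mpoly" assume "p \<in> (\<lambda>i. mvar i ^ 2) ` {1..n}"
    then obtain i where i: "i \<in> {1..n}" "p = mvar i ^ 2" by blast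
    then have p: "p = Poly_Mapping.single (Poly_Mapping.single i 2) 1"
      unfolding mvar_def power2_eq_square i(2) mult_single
      by (simp flip: single_add numeral_2_eq_2)
    then have "p \<in> homogeneous_part n 2"
      using i(1) by (simp add: homogeneous_part_def polynomials_def monomial_degree_def)
    then show "p \<in> (\<Union>d. homogeneous_part n d)" by blast
  qed
qed (rule refl)

lemma homogeneous_part_subset: "homogeneous_part n d \<subseteq> polynomials n"
  by (auto simp: homogeneous_part_def)

lemma sum_mvar_homogeneous: "(\<Sum>i\<in>{1..n}. mvar i :: 'k::field mpoly) \<in> homogeneous_part n 1"
proof -
  have "Poly_Mapping.keys m \<subseteq> {1..n} \<and> monomial_degree m = 1"
    if m: "m \<in> Poly_Mapping.keys (\<Sum>i\<in>{1..n}. mvar i :: 'k mpoly)" for m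
  proof -
    have "(\<Sum>i\<in>{1..n}. Poly_Mapping.lookup (mvar i :: 'k mpoly) m) \<noteq> 0"
      using m unfolding in_keys_iff lookup_sum .
    then obtain i where i: "i \<in> {1..n}" "Poly_Mapping.lookup (mvar i :: 'k mpoly) m \<noteq> 0"
      by (rule sum.not_neutral_contains_not_neutral)
    then have "m = Poly_Mapping.single i 1"
      by (simp add: mvar_def lookup_single when_def split: if_splits)
    with i(1) show ?thesis by (simp add: monomial_degree_def)
  qed
  then show ?thesis
    unfolding homogeneous_part_def polynomials_def mpoly_ring_simps by blast
qed

section \<open>The quotient algebra in squarefree coordinates\<close>

locale square_quotient =
  fixes n :: nat and I :: "'k::field mpoly set"
  assumes I_def: "I = Idl\<^bsub>mpoly_ring n\<^esub> ((\<lambda>i. mvar i ^ 2) ` {1..n})"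
begin

sublocale cring "mpoly_ring n :: 'k mpoly ring"
  by (rule cring_mpoly_ring)

sublocale I: ideal I "mpoly_ring n"
  unfolding I_def
proof (rule genideal_ideal)
  show "(\<lambda>i. mvar i ^ 2) ` {1..n} \<subseteq> carrier (mpoly_ring n :: 'k mpoly ring)"
    using mvar_in_mpoly_ring nat_pow_closed[of _ 2]
    by (fastforce simp: mpoly_ring_pow)
qed

sublocale proj: ring_hom_ring "mpoly_ring n" "mpoly_ring n Quot I" "(+>\<^bsub>mpoly_ring n\<^esub>) I"
  by (rule I.rcos_ring_hom_ring)

text \<open>The ideal is the kernel of \<open>sqfree_coeffs n\<close> on the polynomial ring, so
  these coefficients are faithful coordinates on the quotient.\<close>

lemma coset_eq_iff:
  assumes "p \<in> polynomials n" "q \<in> polynomials n"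
  shows "I +>\<^bsub>mpoly_ring n\<^esub> p = I +>\<^bsub>mpoly_ring n\<^esub> q \<longleftrightarrow> sqfree_coeffs n p = sqfree_coeffs n q"
proof -
  have "p - q \<in> polynomials n"
    using minus_closed[of p q] assms by (simp add: mpoly_ring_minus)
  moreover have "p - q \<in> I \<longleftrightarrow> I +>\<^bsub>mpoly_ring n\<^esub> p = I +>\<^bsub>mpoly_ring n\<^esub> q"
    using quotient_eq_iff_same_a_r_cos[OF I.is_ideal, of p q] assms by (simp add: mpoly_ring_minus)
  ultimately show ?thesis
    unfolding I_def square_ideal_eq by (simp add: sqfree_coeffs_diff)
qed

lemma coset_power_mult:
  assumes "l \<in> polynomials n" "p \<in> polynomials n"
  shows "((I +>\<^bsub>mpoly_ring n\<^esub> l) [^]\<^bsub>mpoly_ring n Quot I\<^esub> (s::nat)) \<otimes>\<^bsub>mpoly_ring n Quot I\<^esub>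
    (I +>\<^bsub>mpoly_ring n\<^esub> p) = I +>\<^bsub>mpoly_ring n\<^esub> (l ^ s * p)"
proof -
  have "l ^ s \<in> polynomials n"
    using nat_pow_closed[of l s] assms by (simp add: mpoly_ring_pow)
  then show ?thesis
    using proj.hom_nat_pow[of l s] proj.hom_mult[of "l ^ s" p] assms by (simp add: mpoly_ring_pow)
qed

text \<open>In squarefree coordinates, ideals of the quotient become subspaces of functions on the
  finite set \<open>Pow {1..n}\<close>, where descending chains stabilise.\<close>

lemma artinian_quotient: "artinian_ring (mpoly_ring n Quot I)"
proof (intro artinian_ring.intro artinian_ring_axioms.intro)
  show "ring (mpoly_ring n Quot I)" by (rule I.quotient_is_ring)
  fix J assume J: "\<And>k. ideal (J k) (mpoly_ring n Quot I)" and dec: "\<And>k. J (Suc k) \<subseteq> J k"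
  define W where "W k = sqfree_coeffs n ` {p \<in> polynomials n. I +>\<^bsub>mpoly_ring n\<^esub> p \<in> J k}" for k :: nat
  have "\<exists>N. \<forall>k\<ge>N. W k = W N"
  proof (rule descending_subspaces_stabilise)
    show "finite (Pow {1..n})" by simp
  next
    fix k f assume "f \<in> W k"
    then obtain p where f: "f = sqfree_coeffs n p" by (auto simp: W_def)
    show "{S. f S \<noteq> 0} \<subseteq> Pow {1..n}"
    proof
      fix S assume "S \<in> {S. f S \<noteq> 0}"
      then show "S \<in> Pow {1..n}"
        by (cases "S \<subseteq> {1..n}") (simp_all add: f sqfree_coeffs_def)
    qed
  next
    fix k f g assume "f \<in> W k" "g \<in> W k"
    then obtain p q where p: "p \<in> polynomials n" "I +>\<^bsub>mpoly_ring n\<^esub> p \<in> J k" "f = sqfree_coeffs n p"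
      and q: "q \<in> polynomials n" "I +>\<^bsub>mpoly_ring n\<^esub> q \<in> J k" "g = sqfree_coeffs n q"
      by (auto simp: W_def)
    interpret J: ideal "J k" "mpoly_ring n Quot I" by (rule J)
    have "p + q \<in> polynomials n" "I +>\<^bsub>mpoly_ring n\<^esub> (p + q) \<in> J k"
      using add.m_closed[of p q] proj.hom_add[of p q] J.a_closed[OF p(2) q(2)] p(1) q(1) by simp_all
    moreover have "(\<lambda>S. f S + g S) = sqfree_coeffs n (p + q)"
      by (simp add: sqfree_coeffs_add p(3) q(3) fun_eq_iff)
    ultimately show "(\<lambda>S. f S + g S) \<in> W k" by (auto simp: W_def)
  next
    fix k f and c :: 'k assume "f \<in> W k"
    then obtain p where p: "p \<in> polynomials n" "I +>\<^bsub>mpoly_ring n\<^esub> p \<in> J k" "f = sqfree_coeffs n p"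
      by (auto simp: W_def)
    interpret J: ideal "J k" "mpoly_ring n Quot I" by (rule J)
    \<comment> \<open>Scalars act as constant polynomials, so absorption in the ideal yields closure
      under scaling.\<close>
    have c: "Poly_Mapping.single 0 c \<in> polynomials n" by (simp add: polynomials_def)
    have "Poly_Mapping.single 0 c * p \<in> polynomials n"
      "I +>\<^bsub>mpoly_ring n\<^esub> (Poly_Mapping.single 0 c * p) \<in> J k"
      using m_closed[of "Poly_Mapping.single 0 c" p] proj.hom_mult[of "Poly_Mapping.single 0 c" p]
        J.I_l_closed[OF p(2) proj.hom_closed[of "Poly_Mapping.single 0 c"]] p(1) c by simp_all
    moreover have "(\<lambda>S. c * f S) = sqfree_coeffs n (Poly_Mapping.single 0 c * p)"
      by (simp add: sqfree_coeffs_const_mult p(3))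
    ultimately show "(\<lambda>S. c * f S) \<in> W k" by (auto simp: W_def)
  next
    show "W (Suc k) \<subseteq> W k" for k using dec[of k] by (auto simp: W_def)
  qed
  then obtain N where N: "W k = W N" if "k \<ge> N" for k by blast
  \<comment> \<open>The coordinate space \<open>W k\<close> determines the ideal \<open>J k\<close>,
    because equal coefficients mean equal cosets.\<close>
  have sub: "J j \<subseteq> J k" if "W j = W k" for j k
  proof
    fix a assume a: "a \<in> J j"
    interpret J: ideal "J j" "mpoly_ring n Quot I" by (rule J)
    obtain p where p: "p \<in> polynomials n" "a = I +>\<^bsub>mpoly_ring n\<^esub> p"
      using J.Icarr[OF a] by (auto simp: FactRing_def A_RCOSETS_def')
    then have "sqfree_coeffs n p \<in> W k" using a that by (auto simp: W_def)
    then obtain q where "q \<in> polynomials n" "I +>\<^bsub>mpoly_ring n\<^esub> q \<in> J k"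
      "sqfree_coeffs n p = sqfree_coeffs n q"
      by (auto simp: W_def)
    then show "a \<in> J k" using p coset_eq_iff[of p q] by simp
  qed
  have "J k = J N" if "k \<ge> N" for k
    using sub[OF N[OF that]] sub[OF N[OF that, symmetric]] by (rule equalityI)
  then show "\<exists>N. \<forall>k\<ge>N. J k = J N" by blast
qed

text \<open>In coordinates, multiplication by the \<open>s\<close>-th power of the linear form on
  degree \<open>i\<close> is \<open>F^s\<close> from weight \<open>n - 2 i\<close> to weight
  \<open>n - 2 (i + s)\<close>. The sign of \<open>n - 2 i - s\<close> decides which half of hard
  Lefschetz applies.\<close>

lemma strong_lefschetz_sum_mvar:
  assumes char: "CHAR('k) = 0 \<or> CHAR('k) > n"
  shows "strong_lefschetz_element n I (I +>\<^bsub>mpoly_ring n\<^esub> (\<Sum>i\<in>{1..n}. mvar i))"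
proof -
  interpret sl2: sl2_module "\<lambda>c (f :: nat set \<Rightarrow> 'k) S. c * f S" "lefschetz_lower {1..n}"
    "lefschetz_raise {1..n}" "weight_space {1..n}" n
    using sl2_module_weight_space[of "{1..n}", where 'k = 'k] char by simp
  define l where "l = (\<Sum>i\<in>{1..n}. mvar i :: 'k mpoly)"
  define \<mu> where "\<mu> s a = ((I +>\<^bsub>mpoly_ring n\<^esub> l) [^]\<^bsub>mpoly_ring n Quot I\<^esub> s) \<otimes>\<^bsub>mpoly_ring n Quot I\<^esub> a"
    for s :: nat and a
  have l: "l \<in> polynomials n"
    using sum_mvar_homogeneous[of n] homogeneous_part_subset[of n] unfolding l_def by blast
  have \<mu>: "\<mu> s (I +>\<^bsub>mpoly_ring n\<^esub> p) = I +>\<^bsub>mpoly_ring n\<^esub> (l ^ s * p)" if "p \<in> polynomials n" for s p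
    unfolding \<mu>_def using l that by (rule coset_power_mult)
  have closed: "l ^ s * p \<in> polynomials n" if "p \<in> polynomials n" for s p
    using that m_closed[of "l ^ s" p] nat_pow_closed[of l s] l by (simp add: mpoly_ring_pow)
  have coeffs: "sqfree_coeffs n (l ^ s * p) = (lefschetz_raise {1..n} ^^ s) (sqfree_coeffs n p)" for s p
    unfolding l_def by (rule sqfree_coeffs_power_mult)
  have homog: "p \<in> polynomials n" "sqfree_coeffs n p \<in> weight_space {1..n} (int n - 2 * int d)"
    if "p \<in> homogeneous_part n d" for p :: "'k mpoly" and d
    using that homogeneous_part_subset sqfree_coeffs_homogeneous_part[of n d] by blast+
  \<comment> \<open>With source weight \<open>w = n - 2 i\<close>, the bound says
    \<open>s \<le> w\<close>.\<close>
  have inj: "inj_on (\<mu> s) (quot_part n I i)" if le: "2 * i + s \<le> n" for i s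
  proof (rule inj_onI)
    fix a b assume "a \<in> quot_part n I i" "b \<in> quot_part n I i" and eq: "\<mu> s a = \<mu> s b"
    then obtain p q where p: "p \<in> homogeneous_part n i" "a = I +>\<^bsub>mpoly_ring n\<^esub> p"
      and q: "q \<in> homogeneous_part n i" "b = I +>\<^bsub>mpoly_ring n\<^esub> q"
      by (auto simp: quot_part_def)
    have "sqfree_coeffs n (l ^ s * p) = sqfree_coeffs n (l ^ s * q)"
      using eq coset_eq_iff[OF closed closed] homog(1)[OF p(1)] homog(1)[OF q(1)]
      by (simp add: p(2) q(2) \<mu>)
    then have "sqfree_coeffs n (l ^ s * (p - q)) = 0"
      by (simp add: right_diff_distrib sqfree_coeffs_diff)
    then have zero: "(lefschetz_raise {1..n} ^^ s) (sqfree_coeffs n p - sqfree_coeffs n q) = 0"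
      unfolding coeffs sqfree_coeffs_diff .
    have "sqfree_coeffs n p - sqfree_coeffs n q \<in> weight_space {1..n} (int n - 2 * int i)"
      using homog(2)[OF p(1)] homog(2)[OF q(1)] by (rule sl2.subspace_diff[OF sl2.subspace_W])
    from sl2.F_power_inj[OF this zero] have "sqfree_coeffs n p - sqfree_coeffs n q = 0"
      using le by simp
    then show "a = b"
      using coset_eq_iff[of p q] homog(1)[OF p(1)] homog(1)[OF q(1)] by (simp add: p(2) q(2))
  qed
  \<comment> \<open>With target weight \<open>w = n - 2 (i + s)\<close>, the bound says
    \<open>s \<le> - w\<close>.\<close>
  have surj: "\<mu> s ` quot_part n I i = quot_part n I (i + s)" if ge: "n \<le> 2 * i + s" for i s
  proof (intro equalityI subsetI)
    fix b assume "b \<in> \<mu> s ` quot_part n I i"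
    then obtain p where p: "p \<in> homogeneous_part n i" "b = \<mu> s (I +>\<^bsub>mpoly_ring n\<^esub> p)"
      by (auto simp: quot_part_def)
    have "sqfree_coeffs n (l ^ s * p) \<in> weight_space {1..n} (int n - 2 * int (i + s))"
      using sl2.F_power_weight[OF homog(2)[OF p(1)], of s]
      unfolding coeffs by (simp add: algebra_simps)
    \<comment> \<open>A homogeneous representative of the product's coset is read off from its
      coefficients.\<close>
    then obtain q where q: "q \<in> homogeneous_part n (i + s)" "sqfree_coeffs n (l ^ s * p) = sqfree_coeffs n q"
      unfolding sqfree_coeffs_homogeneous_part[symmetric] by blast
    then have "b = I +>\<^bsub>mpoly_ring n\<^esub> q"
      using coset_eq_iff[OF closed[OF homog(1)[OF p(1)]] homog(1)[OF q(1)], of s] homog(1)[OF p(1)]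
      by (simp add: p(2) \<mu>)
    then show "b \<in> quot_part n I (i + s)" using q(1) by (simp add: quot_part_def)
  next
    fix b assume "b \<in> quot_part n I (i + s)"
    then obtain q where q: "q \<in> homogeneous_part n (i + s)" "b = I +>\<^bsub>mpoly_ring n\<^esub> q"
      by (auto simp: quot_part_def)
    have "\<exists>u\<in>weight_space {1..n} (int n - 2 * int (i + s) + 2 * int s).
        (lefschetz_raise {1..n} ^^ s) u = sqfree_coeffs n q"
      using ge by (intro sl2.F_power_surj homog(2)[OF q(1)]) simp
    moreover have "int n - 2 * int (i + s) + 2 * int s = int n - 2 * int i" by simp
    ultimately obtain p where p: "p \<in> homogeneous_part n i"
      "(lefschetz_raise {1..n} ^^ s) (sqfree_coeffs n p) = sqfree_coeffs n q"
      using sqfree_coeffs_homogeneous_part[of n i, where 'k = 'k] by (metis imageE)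
    then have "b = \<mu> s (I +>\<^bsub>mpoly_ring n\<^esub> p)"
      using coset_eq_iff[OF closed[OF homog(1)[OF p(1)]] homog(1)[OF q(1)], of s] homog(1)[OF p(1)]
      by (simp add: q(2) \<mu> coeffs)
    then show "b \<in> \<mu> s ` quot_part n I i" using p(1) by (simp add: quot_part_def)
  qed
  have "inj_on (\<mu> s) (quot_part n I i) \<or> \<mu> s ` quot_part n I i = quot_part n I (i + s)" for i s
    using inj[of i s] surj[of i s] by linarith
  moreover have "I +>\<^bsub>mpoly_ring n\<^esub> l \<in> quot_part n I 1"
    unfolding quot_part_def l_def using sum_mvar_homogeneous by (rule imageI)
  ultimately show ?thesis
    unfolding strong_lefschetz_element_def Let_def \<mu>_def l_def by blast
qed

end

theorem theorem2p7:
  fixes n :: nat and I :: "'k::field mpoly set"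
  assumes "n \<ge> 1"
    and "CHAR('k) = 0 \<or> CHAR('k) > n"
    and "I = Idl\<^bsub>mpoly_ring n\<^esub> ((\<lambda>i. mvar i ^ 2) ` {1..n})"
  shows "strong_lefschetz_property n I \<and>
    strong_lefschetz_element n I (I +>\<^bsub>mpoly_ring n\<^esub> (\<Sum>i\<in>{1..n}. mvar i))"
proof -
  interpret square_quotient n I by standard (rule assms(3))
  show ?thesis
    using strong_lefschetz_sum_mvar[OF assms(2)] artinian_quotient homogeneous_ideal_squares[of n]
    unfolding strong_lefschetz_property_def assms(3) by blast
qed

end
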